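(* Let $Q$ be a stably Gelfand unital quantal frame such that $\bigvee\mathcal I(Q)=1$. Then $Q$ is an inverse quantal frame.
   Context: An involutive quantale is a complete lattice $Q$ (top element $1$) with an associative multiplication that preserves arbitrary joins in each variable and a join-preserving involution $a\mapsto a^*$ satisfying $a^{**}=a$ and $(ab)^*=b^*a^*$. It is unital if the multiplication has a unit $e$. It is stably Gelfand if for every $a\in Q$, $aa^*a\le a$ implies $aa^*a=a$. A quantal frame here means an involutive quantal frame, that is, an involutive quantale $Q$ satisfying $a\wedge\bigvee Y=\bigvee_{y\in Y}a\wedge y$ for all $a\in Q$ and $Y\subset Q$. For $Q$ unital, the set of partial units is $\mathcal I(Q)=\{a\in Q\mid a^*a\le e,\ aa^*\le e\}$. An inverse quantal frame is a unital involutive quantal frame $Q$ such that $\bigvee\mathcal I(Q)=1$ and such that for all $a\in Q$ both $a1\wedge e\le aa^*$ and $a\le (a1\wedge e)a$ hold. *)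

theory Defs
  imports Main
begin

unbundle lattice_syntax

text \<open>The underlying complete lattice is a type of class \<^class>\<open>complete_lattice\<close>; the
  multiplication, the involution and the unit are locale parameters.\<close>

locale involutive_quantale = semigroup mult
  for mult :: "'a::complete_lattice \<Rightarrow> 'a \<Rightarrow> 'a" (infixl \<open>\<cdot>\<close> 70) +
  fixes star :: "'a \<Rightarrow> 'a" (\<open>(_\<^sup>\<star>)\<close> [1000] 999)
  assumes mult_Sup: "a \<cdot> \<Squnion>Y = (\<Squnion>y\<in>Y. a \<cdot> y)"
    and Sup_mult: "\<Squnion>Y \<cdot> a = (\<Squnion>y\<in>Y. y \<cdot> a)"
    and star_Sup: "(\<Squnion>Y)\<^sup>\<star> = (\<Squnion>y\<in>Y. y\<^sup>\<star>)"
    and star_star: "(a\<^sup>\<star>)\<^sup>\<star> = a"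
    and star_mult: "(a \<cdot> b)\<^sup>\<star> = b\<^sup>\<star> \<cdot> a\<^sup>\<star>"

locale stably_gelfand_quantale = involutive_quantale +
  assumes stably_gelfand: "a \<cdot> a\<^sup>\<star> \<cdot> a \<le> a \<Longrightarrow> a \<cdot> a\<^sup>\<star> \<cdot> a = a"

text \<open>The class \<open>complete_distrib_lattice\<close> of the library demands complete
  distributivity and is therefore stronger than the frame law below.\<close>

locale quantal_frame = involutive_quantale mult star
  for mult :: "'a::complete_lattice \<Rightarrow> 'a \<Rightarrow> 'a" (infixl \<open>\<cdot>\<close> 70)
    and star :: "'a \<Rightarrow> 'a" (\<open>(_\<^sup>\<star>)\<close> [1000] 999) +
  assumes inf_Sup_frame: "(a::'a) \<sqinter> \<Squnion>Y = (\<Squnion>y\<in>Y. a \<sqinter> y)"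

locale unital_involutive_quantale = involutive_quantale mult star + monoid mult e
  for mult :: "'a::complete_lattice \<Rightarrow> 'a \<Rightarrow> 'a" (infixl \<open>\<cdot>\<close> 70)
    and star :: "'a \<Rightarrow> 'a" (\<open>(_\<^sup>\<star>)\<close> [1000] 999)
    and e :: 'a
begin

definition partial_units :: "'a set"
  where "partial_units = {a. a\<^sup>\<star> \<cdot> a \<le> e \<and> a \<cdot> a\<^sup>\<star> \<le> e}"

end

locale unital_quantal_frame = unital_involutive_quantale + quantal_frame

locale inverse_quantal_frame = unital_quantal_frame +
  assumes Sup_partial_units: "\<Squnion>partial_units = \<top>"
    and support_le: "(a \<cdot> \<top>) \<sqinter> e \<le> a \<cdot> a\<^sup>\<star>"
    and le_support_mult: "a \<le> ((a \<cdot> \<top>) \<sqinter> e) \<cdot> a"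

end

theory Submission
  imports Defs
begin

text \<open>
  A partial unit \<open>s\<close> satisfies \<open>s \<cdot> s\<^sup>\<star> \<cdot> s \<le> s\<close>, hence \<open>s \<cdot> s\<^sup>\<star> \<cdot> s = s\<close> since the quantale is
  stably Gelfand (lemma \<open>partial_unit_regular\<close>); both laws of an inverse quantal frame follow
  from this. By the frame law and \<open>\<Squnion>partial_units = \<top>\<close>, every element \<open>a\<close> is the join of the
  partial units \<open>s \<le> a\<close>, and each of these satisfies \<open>s = s \<cdot> s\<^sup>\<star> \<cdot> s \<le> (a \<cdot> \<top> \<sqinter> e) \<cdot> a\<close> because
  \<open>s \<cdot> s\<^sup>\<star> \<le> a \<cdot> \<top> \<sqinter> e\<close>. On the other hand, \<open>a \<cdot> \<top> \<sqinter> e\<close> is the join of the elements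
  \<open>u = a \<cdot> t \<sqinter> e\<close> with \<open>t\<close> a partial unit. Elements below \<open>e\<close> are partial units, so
  \<open>u = u \<cdot> u\<^sup>\<star> \<cdot> u \<le> u \<cdot> u\<^sup>\<star> \<le> a \<cdot> t \<cdot> t\<^sup>\<star> \<cdot> a\<^sup>\<star> \<le> a \<cdot> a\<^sup>\<star>\<close>.
\<close>

context involutive_quantale
begin

lemma mult_right_mono: "b \<le> c \<Longrightarrow> a \<cdot> b \<le> a \<cdot> c"
  using mult_Sup[of a "{b, c}"] by (simp add: sup.absorb2 le_iff_sup)

lemma mult_left_mono: "b \<le> c \<Longrightarrow> b \<cdot> a \<le> c \<cdot> a"
  using Sup_mult[of "{b, c}" a] by (simp add: sup.absorb2 le_iff_sup)

lemma mult_mono: "a \<le> b \<Longrightarrow> c \<le> d \<Longrightarrow> a \<cdot> c \<le> b \<cdot> d"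
  by (rule order_trans[OF mult_left_mono mult_right_mono])

lemma star_mono: "a \<le> b \<Longrightarrow> a\<^sup>\<star> \<le> b\<^sup>\<star>"
  using star_Sup[of "{a, b}"] by (simp add: sup.absorb2 le_iff_sup)

end

context unital_involutive_quantale
begin

lemma star_unit: "e\<^sup>\<star> = e"
  using star_mult[of "e\<^sup>\<star>" e] by (simp add: star_star)

lemma partial_units_downset:
  assumes "s \<in> partial_units" "r \<le> s"
  shows "r \<in> partial_units"
proof -
  have "r\<^sup>\<star> \<cdot> r \<le> s\<^sup>\<star> \<cdot> s" "r \<cdot> r\<^sup>\<star> \<le> s \<cdot> s\<^sup>\<star>"
    using assms(2) by (simp_all add: mult_mono star_mono)
  then show ?thesis
    using assms(1) unfolding partial_units_def by (auto intro: order_trans)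
qed

lemma unit_partial_unit: "e \<in> partial_units"
  by (simp add: partial_units_def star_unit)

end

context unital_quantal_frame
begin

lemma Sup_partial_units_below:
  assumes "\<Squnion>partial_units = \<top>"
  shows "\<Squnion>{s \<in> partial_units. s \<le> a} = a"
proof (rule antisym)
  have "a = (\<Squnion>s\<in>partial_units. a \<sqinter> s)"
    using inf_Sup_frame[of a partial_units] assms by simp
  also have "\<dots> \<le> \<Squnion>{s \<in> partial_units. s \<le> a}"
    by (rule SUP_least, rule Sup_upper) (auto intro: partial_units_downset)
  finally show "a \<le> \<Squnion>{s \<in> partial_units. s \<le> a}" .
qed (auto intro: Sup_least)

end

text \<open>Unital involutive quantales that are stably Gelfand, without the frame law.\<close>

locale stably_gelfand_unital_quantale =
  unital_involutive_quantale + stably_gelfand_quantale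
begin

lemma partial_unit_regular:
  assumes "s \<in> partial_units"
  shows "s \<cdot> s\<^sup>\<star> \<cdot> s = s"
  using assms mult_left_mono[of "s \<cdot> s\<^sup>\<star>" e s]
  by (auto simp: partial_units_def intro!: stably_gelfand)

lemma le_mult_star_if_le_unit:
  assumes "u \<le> e"
  shows "u \<le> u \<cdot> u\<^sup>\<star>"
proof -
  have "u = u \<cdot> u\<^sup>\<star> \<cdot> u"
    using partial_unit_regular partial_units_downset[OF unit_partial_unit assms] by simp
  also have "\<dots> \<le> u \<cdot> u\<^sup>\<star>"
    using mult_right_mono[OF assms, of "u \<cdot> u\<^sup>\<star>"] by simp
  finally show ?thesis .
qed

end

text \<open>Stably Gelfand unital quantal frames in which the partial units cover the top element.\<close>

locale covered_stably_gelfand_frame =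
  unital_quantal_frame + stably_gelfand_unital_quantale +
  assumes cover: "\<Squnion>partial_units = \<top>"
begin

lemma mult_top_inf_unit_le: "(a \<cdot> \<top>) \<sqinter> e \<le> a \<cdot> a\<^sup>\<star>"
proof -
  have "(a \<cdot> \<top>) \<sqinter> e = e \<sqinter> (\<Squnion>t\<in>partial_units. a \<cdot> t)"
    unfolding cover[symmetric] mult_Sup by (rule inf.commute)
  also have "\<dots> = (\<Squnion>t\<in>partial_units. e \<sqinter> (a \<cdot> t))"
    by (simp add: inf_Sup_frame image_image)
  also have "\<dots> \<le> a \<cdot> a\<^sup>\<star>"
  proof (rule SUP_least)
    fix t assume t: "t \<in> partial_units"
    let ?u = "e \<sqinter> (a \<cdot> t)"
    have "?u \<le> ?u \<cdot> ?u\<^sup>\<star>"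
      by (rule le_mult_star_if_le_unit) simp
    also have "\<dots> \<le> (a \<cdot> t) \<cdot> (a \<cdot> t)\<^sup>\<star>"
      by (intro mult_mono star_mono) simp_all
    also have "\<dots> = a \<cdot> (t \<cdot> t\<^sup>\<star>) \<cdot> a\<^sup>\<star>"
      by (simp add: star_mult assoc)
    also have "\<dots> \<le> a \<cdot> e \<cdot> a\<^sup>\<star>"
      using t by (intro mult_left_mono mult_right_mono) (simp add: partial_units_def)
    finally show "?u \<le> a \<cdot> a\<^sup>\<star>" by simp
  qed
  finally show ?thesis .
qed

lemma le_mult_top_inf_unit_mult: "a \<le> ((a \<cdot> \<top>) \<sqinter> e) \<cdot> a"
proof -
  have "s \<le> ((a \<cdot> \<top>) \<sqinter> e) \<cdot> a" if s: "s \<in> partial_units" "s \<le> a" for s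
  proof -
    have "s \<cdot> s\<^sup>\<star> \<le> (a \<cdot> \<top>) \<sqinter> e"
      using s by (simp add: mult_mono partial_units_def)
    then have "s \<cdot> s\<^sup>\<star> \<cdot> s \<le> ((a \<cdot> \<top>) \<sqinter> e) \<cdot> a"
      using s(2) by (rule mult_mono)
    then show ?thesis
      using partial_unit_regular[OF s(1)] by simp
  qed
  then have "\<Squnion>{s \<in> partial_units. s \<le> a} \<le> ((a \<cdot> \<top>) \<sqinter> e) \<cdot> a"
    by (auto intro: Sup_least)
  then show ?thesis
    by (simp only: Sup_partial_units_below[OF cover])
qed

lemma inverse_quantal_frame: "inverse_quantal_frame mult star e"
  by unfold_locales (fact cover mult_top_inf_unit_le le_mult_top_inf_unit_mult)+

end

theorem corollary5p2:
  fixes mult :: "'a::complete_lattice \<Rightarrow> 'a \<Rightarrow> 'a"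
    and star :: "'a \<Rightarrow> 'a"
    and e :: 'a
  assumes "unital_quantal_frame mult star e"
    and "stably_gelfand_quantale mult star"
    and "Sup (unital_involutive_quantale.partial_units mult star e) = top"
  shows "inverse_quantal_frame mult star e"
proof -
  interpret unital_quantal_frame mult star e by fact
  interpret stably_gelfand_quantale mult star by fact
  interpret covered_stably_gelfand_frame mult star e
    by unfold_locales fact
  show ?thesis by (rule inverse_quantal_frame)
qed

end
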